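(* Let $(\mathbb{X},\mathbb{Z}^d)$ be a faithful subshift with trivial centraliser. Consider an element $H\in\mathcal{R}(\mathbb{X})$ with $h_{\psi(H)}\in\mathrm{Aut}(\mathbb{X})$. Then $H$ is an affine mapping and $h_{\psi(H)}\in\mathcal{R}(\mathbb{X})$.
   Context: $\mathbb{X}$ is a closed shift-invariant subset of $\{0,1\}^{\mathbb{Z}^d}$ (product topology), where the shift action of $\mathbb{Z}^d$ is $(T_tx)_n=x_{n+t}$. Faithful means that the subshift contains non-periodic elements; in particular, $t\mapsto T_t|_{\mathbb{X}}$ is injective. Configurations $x$ are identified with their supports $U\subseteq\mathbb{Z}^d$, so $T_t(U)=U-t$. $\mathrm{Aut}(\mathbb{X})$ is the group of all homeomorphisms of $\mathbb{X}$, $\mathcal{G}=\{T_t|_{\mathbb{X}} : t\in\mathbb{Z}^d\}\simeq\mathbb{Z}^d$, $\mathcal{S}(\mathbb{X})$ is the centraliser and $\mathcal{R}(\mathbb{X})=\{H\in\mathrm{Aut}(\mathbb{X}) : H\mathcal{G}H^{-1}=\mathcal{G}\}$ the normaliser of $\mathcal{G}$ in $\mathrm{Aut}(\mathbb{X})$. Trivial centraliser means $\mathcal{S}(\mathbb{X})=\mathcal{G}$. The homomorphism $\psi:\mathcal{R}(\mathbb{X})\to\mathrm{Aut}(\mathbb{Z}^d)=\mathrm{GL}(d,\mathbb{Z})$ is defined by $HT_nH^{-1}=T_{\psi(H)n}$ for all $n\in\mathbb{Z}^d$. For $M\in\mathrm{GL}(d,\mathbb{Z})$, $h_M$ is the map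 on $\{0,1\}^{\mathbb{Z}^d}$ given by $(h_M(x))_n=x_{M^{-1}n}$, i.e. $h_M(U)=MU$; $h_M\in\mathrm{Aut}(\mathbb{X})$ means that $h_M$ restricts to a homeomorphism of $\mathbb{X}$ onto itself. $H$ is an affine mapping if there are $t\in\mathbb{Z}^d$ and $M\in\mathrm{GL}(d,\mathbb{Z})$ with $H(U)=M(U)+t$ for all $U\in\mathbb{X}$. *)

theory Defs
  imports "HOL-Analysis.Analysis" "HOL-Algebra.Bij" "HOL-Algebra.Group_Action"
begin

text \<open>
  The group \<open>\<int>\<^sup>d\<close> is the type \<open>int ^ 'n\<close>, so that \<open>d\<close> is the cardinality of the index type.
  \<open>True\<close> and \<open>False\<close> play the roles of the symbols 1 and 0. The library topology on \<^typ>\<open>bool\<close>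
  is discrete and the one on function types is the product topology.
\<close>

type_synonym 'n config = "int ^ 'n \<Rightarrow> bool"

definition support :: "'n::finite config \<Rightarrow> (int ^ 'n) set" where
  "support x = {n. x n}"

definition shift :: "int ^ 'n \<Rightarrow> 'n::finite config \<Rightarrow> 'n config" where
  "shift t x = (\<lambda>n. x (n + t))"

definition subshift :: "'n::finite config set \<Rightarrow> bool" where
  "subshift X \<longleftrightarrow> closed X \<and> (\<forall>t. shift t ` X = X)"

text \<open>A configuration is non-periodic if it has no period other than 0.\<close>

definition nonperiodic :: "'n::finite config \<Rightarrow> bool" where
  "nonperiodic x \<longleftrightarrow> (\<forall>t. shift t x = x \<longrightarrow> t = 0)"

definition faithful_shift :: "'n::finite config set \<Rightarrow> bool" where
  "faithful_shift X \<longleftrightarrow> (\<exists>x\<in>X. nonperiodic x)"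

text \<open>
  Self-maps of \<open>X\<close> are represented by functions that are \<^term>\<open>undefined\<close> outside \<open>X\<close>
  (as for \<^const>\<open>BijGroup\<close>); maps of the full shift therefore enter through \<^const>\<open>restrict\<close>.
\<close>

definition homeo_group :: "'a::topological_space set \<Rightarrow> ('a \<Rightarrow> 'a) monoid" where
  "homeo_group X = BijGroup X
     \<lparr>carrier := {f \<in> Bij X. homeomorphic_map (top_of_set X) (top_of_set X) f}\<rparr>"

definition shift_on :: "'n::finite config set \<Rightarrow> int ^ 'n \<Rightarrow> 'n config \<Rightarrow> 'n config" where
  "shift_on X t = restrict (shift t) X"

definition shift_group :: "'n::finite config set \<Rightarrow> ('n config \<Rightarrow> 'n config) set" where
  "shift_group X = range (shift_on X)"

definition centralizer :: "('a, 'b) monoid_scheme \<Rightarrow> 'a set \<Rightarrow> 'a set" where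
  "centralizer G A = {g \<in> carrier G. \<forall>a\<in>A. g \<otimes>\<^bsub>G\<^esub> a = a \<otimes>\<^bsub>G\<^esub> g}"

definition symmetry_group :: "'n::finite config set \<Rightarrow> ('n config \<Rightarrow> 'n config) set" where
  "symmetry_group X = centralizer (homeo_group X) (shift_group X)"

definition extended_symmetry_group :: "'n::finite config set \<Rightarrow> ('n config \<Rightarrow> 'n config) set" where
  "extended_symmetry_group X = normalizer (homeo_group X) (shift_group X)"

definition trivial_centralizer :: "'n::finite config set \<Rightarrow> bool" where
  "trivial_centralizer X \<longleftrightarrow> symmetry_group X = shift_group X"

definition GLZ :: "(int ^ 'n ^ 'n::finite) set" where
  "GLZ = {M. invertible M}"

text \<open>Existence and uniqueness of this matrix are established in \<open>psi_ex1\<close> below.\<close>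

definition psi :: "'n::finite config set \<Rightarrow> ('n config \<Rightarrow> 'n config) \<Rightarrow> int ^ 'n ^ 'n" where
  "psi X H = (THE M. M \<in> GLZ \<and>
     (\<forall>n. H \<otimes>\<^bsub>homeo_group X\<^esub> shift_on X n \<otimes>\<^bsub>homeo_group X\<^esub> inv\<^bsub>homeo_group X\<^esub> H
          = shift_on X (M *v n)))"

definition h :: "int ^ 'n ^ 'n \<Rightarrow> 'n::finite config \<Rightarrow> 'n config" where
  "h M x = (\<lambda>n. x (matrix_inv M *v n))"

definition affine_map_on :: "'n::finite config set \<Rightarrow> ('n config \<Rightarrow> 'n config) \<Rightarrow> bool" where
  "affine_map_on X H \<longleftrightarrow>
     (\<exists>t. \<exists>M\<in>GLZ. \<forall>x\<in>X. support (H x) = (\<lambda>n. M *v n + t) ` support x)"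


lemma group_homeo_group: "group (homeo_group X)"
proof -
  interpret B: group "BijGroup X" by (rule group_BijGroup)
  have "subgroup {f \<in> Bij X. homeomorphic_map (top_of_set X) (top_of_set X) f} (BijGroup X)"
  proof (rule B.subgroupI)
    show "{f \<in> Bij X. homeomorphic_map (top_of_set X) (top_of_set X) f} \<subseteq> carrier (BijGroup X)"
      by (auto simp: BijGroup_def)
    have "homeomorphic_map (top_of_set X) (top_of_set X) (\<lambda>x\<in>X. x)"
      by (rule homeomorphic_map_eq[where f = id]) (auto simp: homeomorphic_map_id)
    then show "{f \<in> Bij X. homeomorphic_map (top_of_set X) (top_of_set X) f} \<noteq> {}"
      using id_Bij by blast
  next
    fix f assume "f \<in> {f \<in> Bij X. homeomorphic_map (top_of_set X) (top_of_set X) f}"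
    then have f: "f \<in> Bij X" "homeomorphic_map (top_of_set X) (top_of_set X) f" by auto
    have bij: "bij_betw f X X" using f by (simp add: Bij_def)
    obtain g where g: "homeomorphic_maps (top_of_set X) (top_of_set X) f g"
      using f(2) homeomorphic_map_maps by blast
    have gX: "g y \<in> X" if "y \<in> X" for y
      using g that unfolding homeomorphic_maps_def continuous_map_def by auto
    have "inv_into X f y = g y" if "y \<in> X" for y
    proof -
      have "f (g y) = y" using g that unfolding homeomorphic_maps_def by auto
      then show ?thesis using gX[OF that] bij by (metis bij_betw_def inv_into_f_f)
    qed
    moreover have "homeomorphic_map (top_of_set X) (top_of_set X) g"
      using g homeomorphic_maps_sym homeomorphic_map_maps by blast
    ultimately have "homeomorphic_map (top_of_set X) (top_of_set X) (\<lambda>x\<in>X. inv_into X f x)"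
      using homeomorphic_map_eq[of "top_of_set X" "top_of_set X" g] by simp
    then show "inv\<^bsub>BijGroup X\<^esub> f \<in> {f \<in> Bij X. homeomorphic_map (top_of_set X) (top_of_set X) f}"
      using f restrict_inv_into_Bij by (auto simp: inv_BijGroup)
  next
    fix f g
    assume "f \<in> {f \<in> Bij X. homeomorphic_map (top_of_set X) (top_of_set X) f}"
      "g \<in> {f \<in> Bij X. homeomorphic_map (top_of_set X) (top_of_set X) f}"
    then have fg: "f \<in> Bij X" "homeomorphic_map (top_of_set X) (top_of_set X) f"
      "g \<in> Bij X" "homeomorphic_map (top_of_set X) (top_of_set X) g" by auto
    have "homeomorphic_map (top_of_set X) (top_of_set X) (compose X f g)"
      by (rule homeomorphic_map_eq[OF homeomorphic_map_compose[OF fg(4) fg(2)]])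
        (auto simp: compose_def)
    then show "f \<otimes>\<^bsub>BijGroup X\<^esub> g \<in> {f \<in> Bij X. homeomorphic_map (top_of_set X) (top_of_set X) f}"
      using fg by (auto simp: BijGroup_def compose_Bij)
  qed
  then show ?thesis unfolding homeo_group_def by (rule B.subgroup_imp_group)
qed

lemma carrier_homeo_group:
  "carrier (homeo_group X) = {f \<in> Bij X. homeomorphic_map (top_of_set X) (top_of_set X) f}"
  by (simp add: homeo_group_def)

lemma mult_homeo_group:
  "f \<in> carrier (homeo_group X) \<Longrightarrow> g \<in> carrier (homeo_group X) \<Longrightarrow>
    f \<otimes>\<^bsub>homeo_group X\<^esub> g = compose X f g"
  by (auto simp: homeo_group_def BijGroup_def)

lemma continuous_shift: "continuous_on S (shift t)"
  unfolding shift_def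
  by (intro continuous_on_coordinatewise_then_product
      continuous_on_subset[OF continuous_on_product_coordinates]) simp

lemma shift_shift: "shift s (shift t x) = shift (s + t) x"
  by (simp add: shift_def add.assoc)

lemma shift_0: "shift 0 x = x"
  by (simp add: shift_def)

lemma shift_on_in_carrier:
  assumes "subshift X"
  shows "shift_on X t \<in> carrier (homeo_group X)"
proof -
  have im: "shift s x \<in> X" if "x \<in> X" for s x
    using assms that unfolding subshift_def by blast
  have "homeomorphic_maps (top_of_set X) (top_of_set X) (shift t) (shift (-t))"
    unfolding homeomorphic_maps_def
    by (auto simp: shift_shift shift_0 im continuous_shift)
  then have "homeomorphic_map (top_of_set X) (top_of_set X) (shift t)"
    using homeomorphic_map_maps by blast
  then have 1: "homeomorphic_map (top_of_set X) (top_of_set X) (shift_on X t)"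
    by (rule homeomorphic_map_eq) (auto simp: shift_on_def)
  have "bij_betw (shift_on X t) X X"
    using 1 by (metis bij_betw_def homeomorphic_imp_injective_map homeomorphic_imp_surjective_map topspace_euclidean_subtopology)
  with 1 show ?thesis
    by (auto simp: carrier_homeo_group Bij_def shift_on_def)
qed

lemma shift_on_mult:
  assumes "subshift X"
  shows "shift_on X s \<otimes>\<^bsub>homeo_group X\<^esub> shift_on X t = shift_on X (s + t)"
proof -
  have im: "shift s x \<in> X" if "x \<in> X" for s x
    using assms that unfolding subshift_def by blast
  have "shift_on X s \<otimes>\<^bsub>homeo_group X\<^esub> shift_on X t = compose X (shift_on X s) (shift_on X t)"
    by (intro mult_homeo_group shift_on_in_carrier assms)
  also have "\<dots> = shift_on X (s + t)"
    by (rule ext) (simp add: compose_def shift_on_def im shift_shift)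
  finally show ?thesis .
qed

lemma shift_on_inj:
  assumes "faithful_shift X" "shift_on X s = shift_on X t"
  shows "s = t"
proof -
  obtain x where x: "x \<in> X" "nonperiodic x" using assms by (auto simp: faithful_shift_def)
  have "shift s x = shift t x" using assms(2) x(1) by (metis restrict_apply' shift_on_def)
  then have "shift (-t + s) x = x" by (metis shift_shift shift_0 add.left_inverse)
  then have "-t + s = 0" using x(2) unfolding nonperiodic_def by blast
  then show ?thesis by simp
qed

lemma additive_int_vec_is_matrix:
  fixes f :: "int ^ 'n \<Rightarrow> int ^ 'n::finite"
  assumes add: "\<And>x y. f (x + y) = f x + f y"
  obtains M where "\<And>x. f x = M *v x"
proof
  interpret additive f by unfold_locales (rule add)
  have sc: "f (k *s v) = k *s f v" for k v
  proof (induction k rule: int_induct[of _ 0])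
    case base then show ?case by (simp add: zero)
  next
    case (step1 i) then show ?case by (simp add: vector_sadd_rdistrib add)
  next
    case (step2 i)
    have "(i - 1) *s w = i *s w - w" for w :: "int ^ 'n"
      by (simp add: vec_eq_iff algebra_simps)
    then show ?case using step2 by (simp add: diff)
  qed
  fix x
  have "f x = f (\<Sum>j\<in>UNIV. x $ j *s axis j 1)" by (simp add: basis_expansion)
  also have "\<dots> = (\<Sum>j\<in>UNIV. x $ j *s f (axis j 1))" by (simp add: sum sc)
  also have "\<dots> = (\<chi> i j. f (axis j 1) $ i) *v x"
    by (simp add: vec_eq_iff matrix_vector_mult_def mult.commute)
  finally show "f x = (\<chi> i j. f (axis j 1) $ i) *v x" .
qed

lemma psi_ex1:
  fixes X :: "'n::finite config set"
  assumes X: "subshift X" "faithful_shift X" and H: "H \<in> extended_symmetry_group X"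
  shows "\<exists>!M. M \<in> GLZ \<and>
     (\<forall>n. H \<otimes>\<^bsub>homeo_group X\<^esub> shift_on X n \<otimes>\<^bsub>homeo_group X\<^esub> inv\<^bsub>homeo_group X\<^esub> H
          = shift_on X (M *v n))"
proof -
  define G where "G = homeo_group X"
  interpret G: group G unfolding G_def by (rule group_homeo_group)
  note S = shift_on_in_carrier[OF X(1), folded G_def]
  note SM = shift_on_mult[OF X(1), folded G_def]
  have sub: "shift_group X \<subseteq> carrier G" using S by (auto simp: shift_group_def)
  have HG: "H \<in> carrier G" and
    eq: "H <#\<^bsub>G\<^esub> shift_group X #>\<^bsub>G\<^esub> inv\<^bsub>G\<^esub> H = shift_group X"
    using H sub unfolding extended_symmetry_group_def normalizer_def stabilizer_def G_def by auto
  have set: "(\<lambda>n. H \<otimes>\<^bsub>G\<^esub> shift_on X n \<otimes>\<^bsub>G\<^esub> inv\<^bsub>G\<^esub> H) ` UNIV = range (shift_on X)"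
    using eq unfolding l_coset_def r_coset_def shift_group_def by auto
  then have "\<forall>n. \<exists>m. H \<otimes>\<^bsub>G\<^esub> shift_on X n \<otimes>\<^bsub>G\<^esub> inv\<^bsub>G\<^esub> H = shift_on X m" by blast
  then obtain f where f: "\<And>n. H \<otimes>\<^bsub>G\<^esub> shift_on X n \<otimes>\<^bsub>G\<^esub> inv\<^bsub>G\<^esub> H = shift_on X (f n)" by metis
  have conj: "(H \<otimes>\<^bsub>G\<^esub> a \<otimes>\<^bsub>G\<^esub> inv\<^bsub>G\<^esub> H) \<otimes>\<^bsub>G\<^esub> (H \<otimes>\<^bsub>G\<^esub> b \<otimes>\<^bsub>G\<^esub> inv\<^bsub>G\<^esub> H)
      = H \<otimes>\<^bsub>G\<^esub> (a \<otimes>\<^bsub>G\<^esub> b) \<otimes>\<^bsub>G\<^esub> inv\<^bsub>G\<^esub> H"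
    if "a \<in> carrier G" "b \<in> carrier G" for a b
  proof -
    have "inv\<^bsub>G\<^esub> H \<otimes>\<^bsub>G\<^esub> (H \<otimes>\<^bsub>G\<^esub> (b \<otimes>\<^bsub>G\<^esub> inv\<^bsub>G\<^esub> H)) = b \<otimes>\<^bsub>G\<^esub> inv\<^bsub>G\<^esub> H"
      using that HG by (simp add: G.m_assoc[symmetric])
    then show ?thesis using that HG by (simp add: G.m_assoc)
  qed
  have fadd: "f (m + n) = f m + f n" for m n
    using conj[OF S[of m] S[of n]] unfolding SM f by (metis shift_on_inj[OF X(2)])
  have finj: "m = n" if "f m = f n" for m n
  proof -
    have "H \<otimes>\<^bsub>G\<^esub> shift_on X m \<otimes>\<^bsub>G\<^esub> inv\<^bsub>G\<^esub> H = H \<otimes>\<^bsub>G\<^esub> shift_on X n \<otimes>\<^bsub>G\<^esub> inv\<^bsub>G\<^esub> H"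
      using f that by simp
    then have "shift_on X m = shift_on X n" using HG S by simp
    then show ?thesis by (rule shift_on_inj[OF X(2)])
  qed
  have fsurj: "\<exists>n. f n = m" for m
  proof -
    have "shift_on X m \<in> range (\<lambda>n. H \<otimes>\<^bsub>G\<^esub> shift_on X n \<otimes>\<^bsub>G\<^esub> inv\<^bsub>G\<^esub> H)" using set by blast
    then obtain n where "shift_on X m = shift_on X (f n)" using f by auto
    then show ?thesis using shift_on_inj[OF X(2)] by metis
  qed
  obtain g where fg: "\<And>m. f (g m) = m" using fsurj by metis
  have gf: "g (f m) = m" for m using fg finj by blast
  have gadd: "g (m + n) = g m + g n" for m n by (rule finj) (simp add: fadd fg)
  obtain A where A: "\<And>x. f x = A *v x" using additive_int_vec_is_matrix[of f] fadd by blast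
  obtain B where B: "\<And>x. g x = B *v x" using additive_int_vec_is_matrix[of g] gadd by blast
  have meq: "M = N" if "\<And>x. M *v x = N *v x" for M N :: "int ^ 'n ^ 'n"
    using that by (simp add: matrix_eq)
  have "A ** B = mat 1" "B ** A = mat 1"
    by (rule meq; simp add: matrix_vector_mul_assoc[symmetric] A[symmetric] B[symmetric] fg gf)+
  then have "A \<in> GLZ" unfolding GLZ_def invertible_def by blast
  show ?thesis unfolding G_def[symmetric]
  proof (rule ex1I[of _ A])
    show "A \<in> GLZ \<and> (\<forall>n. H \<otimes>\<^bsub>G\<^esub> shift_on X n \<otimes>\<^bsub>G\<^esub> inv\<^bsub>G\<^esub> H = shift_on X (A *v n))"
      using \<open>A \<in> GLZ\<close> f A by simp
  next
    fix M assume "M \<in> GLZ \<and> (\<forall>n. H \<otimes>\<^bsub>G\<^esub> shift_on X n \<otimes>\<^bsub>G\<^esub> inv\<^bsub>G\<^esub> H = shift_on X (M *v n))"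
    then have "shift_on X (M *v n) = shift_on X (A *v n)" for n using f A by simp
    then show "M = A" using shift_on_inj[OF X(2)] meq by blast
  qed
qed

end

theory Submission
  imports Defs
begin

text \<open>
  Put \<open>M = psi X H\<close>. The linear map \<^term>\<open>h M\<close> intertwines the shift by \<open>n\<close> with the shift
  by \<open>M n\<close> on the whole configuration space (\<open>h_shift\<close>). Hence, as soon as it acts on \<open>X\<close>,
  it conjugates the shifts of \<open>X\<close> in exactly the way \<open>H\<close> does, and since \<open>M\<close> is surjective on
  \<open>\<int>\<^sup>d\<close>, it normalises the shift group (\<open>intertwiner_in_extended_symmetry_group\<close>).

  Two elements of a group that conjugate a subset in the same way differ by an element of the
  centraliser of that subset (\<open>same_conjugation_imp_centralizer\<close>). The centraliser of the
  shifts being trivial, \<open>H\<close> is the composition of \<^term>\<open>h M\<close> with a shift by some \<open>s\<close>, and so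
  acts on supports by \<open>U \<mapsto> M U - M s\<close>.
\<close>

lemma (in group) conj_eq_iff:
  assumes "g \<in> carrier G" "a \<in> carrier G" "b \<in> carrier G"
  shows "g \<otimes> a \<otimes> inv g = b \<longleftrightarrow> g \<otimes> a = b \<otimes> g"
  using assms by (metis inv_solve_right m_closed)

text \<open>
  From \<open>k a = b k\<close> and \<open>g a = b g\<close>, where \<open>b\<close> is the common conjugate of \<open>a\<close>, it follows that
  \<open>k\<^sup>-\<^sup>1 g a = k\<^sup>-\<^sup>1 b g = a k\<^sup>-\<^sup>1 g\<close>.
\<close>

lemma (in group) same_conjugation_imp_centralizer:
  assumes g: "g \<in> carrier G" and k: "k \<in> carrier G" and A: "A \<subseteq> carrier G"
    and same: "\<And>a. a \<in> A \<Longrightarrow> g \<otimes> a \<otimes> inv g = k \<otimes> a \<otimes> inv k"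
  shows "inv k \<otimes> g \<in> centralizer G A"
proof -
  have "inv k \<otimes> g \<otimes> a = a \<otimes> (inv k \<otimes> g)" if "a \<in> A" for a
  proof -
    have a: "a \<in> carrier G" using that A by blast
    have "g \<otimes> a = k \<otimes> a \<otimes> inv k \<otimes> g"
      using same[OF that] conj_eq_iff[OF g a] k a by simp
    then have "inv k \<otimes> g \<otimes> a = inv k \<otimes> (k \<otimes> (a \<otimes> (inv k \<otimes> g)))"
      using g k a by (simp add: m_assoc)
    also have "\<dots> = a \<otimes> (inv k \<otimes> g)"
      using g k a by (simp add: m_assoc[symmetric])
    finally show ?thesis .
  qed
  then show ?thesis using g k by (simp add: centralizer_def)
qed

lemma matrix_inv_mult_vec:
  assumes "invertible (M :: 'a::semiring_1 ^ 'n ^ 'n)"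
  shows "M *v (matrix_inv M *v x) = x" "matrix_inv M *v (M *v x) = x"
proof -
  have "M ** matrix_inv M = mat 1 \<and> matrix_inv M ** M = mat 1"
    using assms unfolding matrix_inv_def invertible_def by (rule someI_ex)
  then show "M *v (matrix_inv M *v x) = x" "matrix_inv M *v (M *v x) = x"
    by (simp_all add: matrix_vector_mul_assoc)
qed

lemma h_shift:
  assumes "M \<in> GLZ"
  shows "h M (shift n x) = shift (M *v n) (h M x)"
  using assms
  by (simp add: h_def shift_def GLZ_def matrix_vector_right_distrib matrix_inv_mult_vec)

lemma support_shift_h:
  assumes "M \<in> GLZ"
  shows "support (shift t (h M x)) = (\<lambda>n. M *v n + (- t)) ` support x"
proof (intro Set.set_eqI iffI)
  fix m assume "m \<in> support (shift t (h M x))"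
  then have "matrix_inv M *v (m + t) \<in> support x"
    by (simp add: support_def shift_def h_def)
  moreover have "m = M *v (matrix_inv M *v (m + t)) + (- t)"
    using assms by (simp add: matrix_inv_mult_vec GLZ_def)
  ultimately show "m \<in> (\<lambda>n. M *v n + (- t)) ` support x" by blast
next
  fix m assume "m \<in> (\<lambda>n. M *v n + (- t)) ` support x"
  then show "m \<in> support (shift t (h M x))"
    using assms by (auto simp: support_def shift_def h_def matrix_inv_mult_vec GLZ_def)
qed

lemma shift_mem:
  assumes "subshift X" "x \<in> X"
  shows "shift t x \<in> X"
  using assms unfolding subshift_def by blast

lemma conj_h_shift_on:
  assumes X: "subshift X" and M: "M \<in> GLZ"
    and K: "restrict (h M) X \<in> carrier (homeo_group X)"
  shows "restrict (h M) X \<otimes>\<^bsub>homeo_group X\<^esub> shift_on X n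
           \<otimes>\<^bsub>homeo_group X\<^esub> inv\<^bsub>homeo_group X\<^esub> (restrict (h M) X) = shift_on X (M *v n)"
proof -
  note S = shift_on_in_carrier[OF X]
  have KX: "h M x \<in> X" if "x \<in> X" for x
    using K that bij_betwE[of "restrict (h M) X" X X]
    by (auto simp: carrier_homeo_group Bij_def)
  have "compose X (restrict (h M) X) (shift_on X n)
      = compose X (shift_on X (M *v n)) (restrict (h M) X)"
    by (rule ext) (simp add: compose_def shift_on_def shift_mem[OF X] KX h_shift[OF M])
  then have "restrict (h M) X \<otimes>\<^bsub>homeo_group X\<^esub> shift_on X n
      = shift_on X (M *v n) \<otimes>\<^bsub>homeo_group X\<^esub> restrict (h M) X"
    using S K by (simp add: mult_homeo_group)
  then show ?thesis
    using group.conj_eq_iff[OF group_homeo_group K S S] by blast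
qed

lemma intertwiner_in_extended_symmetry_group:
  assumes X: "subshift X" and K: "K \<in> carrier (homeo_group X)" and M: "M \<in> GLZ"
    and conj: "\<And>n. K \<otimes>\<^bsub>homeo_group X\<^esub> shift_on X n \<otimes>\<^bsub>homeo_group X\<^esub> inv\<^bsub>homeo_group X\<^esub> K
                 = shift_on X (M *v n)"
  shows "K \<in> extended_symmetry_group X"
proof -
  have "range (\<lambda>n. M *v n) = UNIV"
    using M by (metis GLZ_def matrix_inv_mult_vec(1) mem_Collect_eq surjI)
  then have "range (\<lambda>n. shift_on X (M *v n)) = shift_group X"
    unfolding shift_group_def by (metis image_image)
  then have "K <#\<^bsub>homeo_group X\<^esub> shift_group X #>\<^bsub>homeo_group X\<^esub> inv\<^bsub>homeo_group X\<^esub> K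
      = shift_group X"
    unfolding l_coset_def r_coset_def using conj by (auto simp: shift_group_def)
  moreover have "shift_group X \<subseteq> carrier (homeo_group X)"
    using shift_on_in_carrier[OF X] by (auto simp: shift_group_def)
  ultimately show ?thesis
    using K by (simp add: extended_symmetry_group_def normalizer_def stabilizer_def)
qed

lemma extended_symmetry_group_in_carrier:
  "H \<in> extended_symmetry_group X \<Longrightarrow> H \<in> carrier (homeo_group X)"
  by (simp add: extended_symmetry_group_def normalizer_def stabilizer_def)

theorem corollary4p7:
  fixes X :: "'n::finite config set"
    and H :: "'n config \<Rightarrow> 'n config"
  assumes "subshift X"
    and "faithful_shift X"
    and "trivial_centralizer X"
    and "H \<in> extended_symmetry_group X"
    and "restrict (h (psi X H)) X \<in> carrier (homeo_group X)"
  shows "affine_map_on X H \<and> restrict (h (psi X H)) X \<in> extended_symmetry_group X"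
proof
  define M where "M = psi X H"
  define K where "K = restrict (h M) X"
  let ?G = "homeo_group X"
  interpret G: group ?G by (rule group_homeo_group)
  note S = shift_on_in_carrier[OF assms(1)]
  have HG: "H \<in> carrier ?G" by (rule extended_symmetry_group_in_carrier[OF assms(4)])
  have KG: "K \<in> carrier ?G" using assms(5) by (simp add: K_def M_def)
  have M: "M \<in> GLZ"
    and conjH: "\<And>n. H \<otimes>\<^bsub>?G\<^esub> shift_on X n \<otimes>\<^bsub>?G\<^esub> inv\<^bsub>?G\<^esub> H = shift_on X (M *v n)"
    using theI'[OF psi_ex1[OF assms(1,2,4)]] unfolding psi_def[symmetric] M_def by blast+
  have conjK: "K \<otimes>\<^bsub>?G\<^esub> shift_on X n \<otimes>\<^bsub>?G\<^esub> inv\<^bsub>?G\<^esub> K = shift_on X (M *v n)" for n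
    using conj_h_shift_on[OF assms(1) M] KG by (simp add: K_def)
  show "restrict (h (psi X H)) X \<in> extended_symmetry_group X"
    using intertwiner_in_extended_symmetry_group[OF assms(1) KG M conjK]
    by (simp add: K_def M_def)
  have "inv\<^bsub>?G\<^esub> K \<otimes>\<^bsub>?G\<^esub> H \<in> symmetry_group X"
    unfolding symmetry_group_def using S conjH conjK
    by (intro G.same_conjugation_imp_centralizer HG KG) (auto simp: shift_group_def)
  then obtain s where "inv\<^bsub>?G\<^esub> K \<otimes>\<^bsub>?G\<^esub> H = shift_on X s"
    using assms(3) by (auto simp: trivial_centralizer_def shift_group_def)
  then have "H = K \<otimes>\<^bsub>?G\<^esub> shift_on X s"
    using HG KG S by (metis G.inv_solve_left)
  then have "H = compose X K (shift_on X s)"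
    using KG S by (simp add: mult_homeo_group)
  then have "H x = shift (M *v s) (h M x)" if "x \<in> X" for x
    using that by (simp add: compose_def K_def shift_on_def shift_mem[OF assms(1)] h_shift[OF M])
  then have "\<forall>x\<in>X. support (H x) = (\<lambda>n. M *v n + (- (M *v s))) ` support x"
    using support_shift_h[OF M] by metis
  then show "affine_map_on X H"
    unfolding affine_map_on_def using M by blast
qed

end
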